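(* Let $G$ be a nontrivial finite group, and let $N$ be a normal subgroup of $G$ such that $|N|$ is odd and $N\le\Phi(G)$. Then $\mathrm{DNG}(G)=\mathrm{DNG}(G/N)$, that is, the games $\mathrm{DNG}(G)$ and $\mathrm{DNG}(G/N)$ have the same nim-number.
   Context: For a nontrivial finite group $G$, the avoidance game $\mathrm{DNG}(G)$ is the impartial game whose positions are the subsets $P\subseteq G$ with $\langle P\rangle\ne G$; the starting position is $\emptyset$; the options of $P$ are the positions of the form $P\cup\{g\}$ with $g\in G\setminus P$ (and $\langle P\cup\{g\}\rangle\neq G$). Two players alternate moves, and a player who cannot move loses (normal play). The nim-number of a position $P$ is defined recursively by $\mathrm{nim}(P)=\mathrm{mex}\{\mathrm{nim}(Q)\mid Q \text{ an option of } P\}$, where $\mathrm{mex}(A)$ is the least non-negative integer not in $A$. The nim-number of the game is the nim-number of its starting position $\emptyset$. The Frattini subgroup $\Phi(G)$ is the intersection of all maximal subgroups of $G$. *)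

theory Defs
  imports "HOL-Algebra.Algebra"
begin

definition maximal_subgroup :: "'a set \<Rightarrow> ('a, 'b) monoid_scheme \<Rightarrow> bool" where
  "maximal_subgroup M G \<longleftrightarrow>
     subgroup M G \<and> M \<noteq> carrier G \<and>
     (\<forall>H. subgroup H G \<longrightarrow> M \<subseteq> H \<longrightarrow> H = M \<or> H = carrier G)"

text \<open>The intersection is taken inside \<open>carrier G\<close>: a group without maximal subgroups is its own
  Frattini subgroup.\<close>

definition frattini :: "('a, 'b) monoid_scheme \<Rightarrow> 'a set" where
  "frattini G = carrier G \<inter> \<Inter> {M. maximal_subgroup M G}"

definition mex :: "nat set \<Rightarrow> nat" where
  "mex A = (LEAST n. n \<notin> A)"

definition DNG_positions :: "('a, 'b) monoid_scheme \<Rightarrow> 'a set set" where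
  "DNG_positions G = {P. P \<subseteq> carrier G \<and> generate G P \<noteq> carrier G}"

definition DNG_moves :: "('a, 'b) monoid_scheme \<Rightarrow> 'a set \<Rightarrow> 'a set set" where
  "DNG_moves G P = {insert g P | g. g \<in> carrier G - P \<and> insert g P \<in> DNG_positions G}"

text \<open>The nim-number of a position. The recursion terminates only for finite \<open>G\<close>; the value \<open>0\<close> for
  infinite \<open>G\<close> carries no meaning.\<close>

function DNG_nim_pos :: "('a, 'b) monoid_scheme \<Rightarrow> 'a set \<Rightarrow> nat" where
  "DNG_nim_pos G P =
     (if finite (carrier G) then mex (DNG_nim_pos G ` DNG_moves G P) else 0)"
  by pat_completeness auto

termination
proof (relation "Wellfounded.measure (\<lambda>(G, P). card (carrier G - P))")
  fix G :: "('a, 'b) monoid_scheme" and P Q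
  assume "finite (carrier G)" and "Q \<in> DNG_moves G P"
  then have "card (carrier G - Q) < card (carrier G - P)"
    unfolding DNG_moves_def by (auto intro!: psubset_card_mono)
  then show "((G, Q), (G, P)) \<in> Wellfounded.measure (\<lambda>(G, P). card (carrier G - P))"
    by simp
qed simp

declare DNG_nim_pos.simps [simp del]

lemma DNG_nim_pos_eq:
  "finite (carrier G) \<Longrightarrow> DNG_nim_pos G P = mex (DNG_nim_pos G ` DNG_moves G P)"
  by (subst DNG_nim_pos.simps) simp

definition DNG_nim :: "('a, 'b) monoid_scheme \<Rightarrow> nat" where
  "DNG_nim G = DNG_nim_pos G {}"

end

theory Submission
  imports Defs
begin

text \<open>Write \<open>K\<close> for \<open>G Mod N\<close> and \<open>f\<close> for the projection. Because \<open>N\<close> lies in the Frattini subgroup,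
  a set generates \<open>G\<close> if and only if its image generates \<open>K\<close>, so legality of a position \<open>P\<close> can be
  read off from the subgroup \<open>generate K (f ` P)\<close>. The claim is that the nim-number of \<open>P\<close> depends
  only on this subgroup and on the parity of \<open>card P\<close>, and does so by the same rule in \<open>G\<close> and in
  \<open>K\<close>.

  To compare \<open>P\<close> in \<open>G\<close> with \<open>Q\<close> in \<open>K\<close> when both span the same subgroup \<open>L\<close> of \<open>K\<close> and have sizes
  of equal parity, let a move be made in one of the games. A move that enlarges \<open>L\<close> is copied in
  the other game. A move inside the preimage of \<open>L\<close> is answered by any move of the other game
  inside its own preimage of \<open>L\<close>, if there is one left. If there is none, the other position fills its whole preimage
  of \<open>L\<close>. All these preimages have cardinalities of the same parity, as \<open>card N\<close> is odd, so after
  the move the first position still leaves some element of the preimage free; taking it restores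
  the original situation, which means that the move was reversible. A move that is copied or
  reversed does not affect the equality of nim-numbers (\<open>DNG_nim_pos_eq_if_matched_or_reversed\<close>).

  The roles of \<open>G\<close> and \<open>K\<close> in this argument are the same once \<open>K\<close> is viewed as a cover of itself by
  the identity; it is therefore carried out for two covers of a common group.\<close>

section \<open>Nim-numbers and reversible moves\<close>

lemma mex_notin:
  assumes "finite A"
  shows "mex A \<notin> A"
  unfolding mex_def using ex_new_if_finite[OF infinite_UNIV_nat assms] by (rule LeastI_ex)

lemma less_mex_in: "n < mex A \<Longrightarrow> n \<in> A"
  unfolding mex_def using not_less_Least by blast

lemma mex_eq_mexI:
  assumes "mex A \<notin> B" and "mex B \<notin> A"
  shows "mex A = mex B"
  using assms less_mex_in by (metis nat_neq_iff)

lemma finite_DNG_moves: "finite (carrier G) \<Longrightarrow> finite (DNG_moves G P)"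
  unfolding DNG_moves_def by simp

lemma DNG_nim_pos_neq_option:
  assumes "finite (carrier G)" and "P' \<in> DNG_moves G P"
  shows "DNG_nim_pos G P' \<noteq> DNG_nim_pos G P"
  using mex_notin[of "DNG_nim_pos G ` DNG_moves G P"] assms
  by (metis DNG_nim_pos_eq finite_DNG_moves finite_imageI imageI)

lemma card_DNG_moves_less:
  assumes "finite (carrier G)" and "P' \<in> DNG_moves G P"
  shows "card (carrier G - P') < card (carrier G - P)"
  using assms unfolding DNG_moves_def by (auto intro!: psubset_card_mono)

text \<open>In the language of sums of games, the hypotheses give the second player a winning reply to
  every move in the sum of \<open>P\<close> and \<open>Q\<close>. In terms of nim-numbers: an option of \<open>P\<close> with the value of
  \<open>Q\<close> cannot be matched, since \<open>Q\<close> would then have an option of its own value, and cannot be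
  reversed, since it would then itself have an option of its own value.\<close>

lemma DNG_nim_pos_eq_if_matched_or_reversed:
  assumes finG: "finite (carrier G)" and finH: "finite (carrier H)"
    and left: "\<And>P Q P'. R P Q \<Longrightarrow> P' \<in> DNG_moves G P \<Longrightarrow>
      (\<exists>Q' \<in> DNG_moves H Q. R P' Q') \<or> (\<exists>P'' \<in> DNG_moves G P'. R P'' Q)"
    and right: "\<And>P Q Q'. R P Q \<Longrightarrow> Q' \<in> DNG_moves H Q \<Longrightarrow>
      (\<exists>P' \<in> DNG_moves G P. R P' Q') \<or> (\<exists>Q'' \<in> DNG_moves H Q'. R P Q'')"
    and "R P Q"
  shows "DNG_nim_pos G P = DNG_nim_pos H Q"
  using \<open>R P Q\<close>
proof (induction "card (carrier G - P) + card (carrier H - Q)" arbitrary: P Q rule: less_induct)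
  case less
  note smallerG = card_DNG_moves_less[OF finG] and smallerH = card_DNG_moves_less[OF finH]
  have "DNG_nim_pos H Q \<notin> DNG_nim_pos G ` DNG_moves G P"
  proof
    assume "DNG_nim_pos H Q \<in> DNG_nim_pos G ` DNG_moves G P"
    then obtain P' where P': "P' \<in> DNG_moves G P" "DNG_nim_pos G P' = DNG_nim_pos H Q"
      by auto
    from left[OF less.prems P'(1)] show False
    proof (elim disjE bexE)
      fix Q' assume Q': "Q' \<in> DNG_moves H Q" "R P' Q'"
      then have "DNG_nim_pos G P' = DNG_nim_pos H Q'"
        using less.hyps smallerG[OF P'(1)] smallerH[OF Q'(1)] by simp
      then show False
        using P'(2) DNG_nim_pos_neq_option[OF finH Q'(1)] by simp
    next
      fix P'' assume P'': "P'' \<in> DNG_moves G P'" "R P'' Q"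
      then have "DNG_nim_pos G P'' = DNG_nim_pos H Q"
        using less.hyps smallerG[OF P'(1)] smallerG[OF P''(1)] by simp
      then show False
        using P'(2) DNG_nim_pos_neq_option[OF finG P''(1)] by simp
    qed
  qed
  moreover have "DNG_nim_pos G P \<notin> DNG_nim_pos H ` DNG_moves H Q"
  proof
    assume "DNG_nim_pos G P \<in> DNG_nim_pos H ` DNG_moves H Q"
    then obtain Q' where Q': "Q' \<in> DNG_moves H Q" "DNG_nim_pos H Q' = DNG_nim_pos G P"
      by auto
    from right[OF less.prems Q'(1)] show False
    proof (elim disjE bexE)
      fix P' assume P': "P' \<in> DNG_moves G P" "R P' Q'"
      then have "DNG_nim_pos G P' = DNG_nim_pos H Q'"
        using less.hyps smallerH[OF Q'(1)] smallerG[OF P'(1)] by simp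
      then show False
        using Q'(2) DNG_nim_pos_neq_option[OF finG P'(1)] by simp
    next
      fix Q'' assume Q'': "Q'' \<in> DNG_moves H Q'" "R P Q''"
      then have "DNG_nim_pos G P = DNG_nim_pos H Q''"
        using less.hyps smallerH[OF Q'(1)] smallerH[OF Q''(1)] by simp
      then show False
        using Q'(2) DNG_nim_pos_neq_option[OF finH Q''(1)] by simp
    qed
  qed
  ultimately show ?case
    using DNG_nim_pos_eq[OF finG, of P] DNG_nim_pos_eq[OF finH, of Q] mex_eq_mexI by metis
qed

section \<open>Generated subgroups as a closure operator\<close>

lemma (in group) generate_subset_generate_iff:
  assumes "A \<subseteq> carrier G" and "B \<subseteq> carrier G"
  shows "generate G A \<subseteq> generate G B \<longleftrightarrow> A \<subseteq> generate G B"
  using assms generate_subgroup_incl generate_is_subgroup generate.incl by (meson subset_iff)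

lemma (in group) generate_insert_absorb:
  assumes "A \<subseteq> carrier G" and "x \<in> generate G A"
  shows "generate G (insert x A) = generate G A"
proof
  have "x \<in> carrier G" using assms generate_incl by blast
  then show "generate G (insert x A) \<subseteq> generate G A"
    using assms by (auto simp: generate_subset_generate_iff intro: generate.incl)
  show "generate G A \<subseteq> generate G (insert x A)"
    by (rule mono_generate) auto
qed

lemma (in group) generate_insert_cong:
  assumes "A \<subseteq> carrier G" and "B \<subseteq> carrier G" and "x \<in> carrier G"
    and "generate G A = generate G B"
  shows "generate G (insert x A) = generate G (insert x B)"
proof -
  have "generate G (insert x A) \<subseteq> generate G (insert x B)"
    if "A \<subseteq> carrier G" "B \<subseteq> carrier G" "generate G A = generate G B" for A B
  proof -
    have "A \<subseteq> generate G B" using generate.incl[of _ A G] that(3) by auto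
    also have "\<dots> \<subseteq> generate G (insert x B)" by (rule mono_generate) auto
    finally show ?thesis
      using that \<open>x \<in> carrier G\<close> by (simp add: generate_subset_generate_iff generate.incl)
  qed
  from this[of A B] this[of B A] show ?thesis using assms by auto
qed

section \<open>Covers with odd fibres\<close>

text \<open>These are the only properties of the projection modulo \<open>N\<close> that the game sees.\<close>

definition odd_generation_cover ::
    "('a, 'b) monoid_scheme \<Rightarrow> ('c, 'd) monoid_scheme \<Rightarrow> ('a \<Rightarrow> 'c) \<Rightarrow> bool" where
  "odd_generation_cover G K f \<longleftrightarrow>
     finite (carrier G) \<and> f ` carrier G = carrier K \<and>
     (\<forall>y \<in> carrier K. odd (card {x \<in> carrier G. f x = y})) \<and>
     (\<forall>P. P \<subseteq> carrier G \<longrightarrow>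
        (generate G P = carrier G \<longleftrightarrow> generate K (f ` P) = carrier K))"

lemma odd_generation_cover_even_card_vimage:
  assumes "odd_generation_cover G K f" and "L \<subseteq> carrier K"
  shows "even (card {x \<in> carrier G. f x \<in> L}) \<longleftrightarrow> even (card L)"
proof -
  have fin: "finite (carrier G)" and surj: "f ` carrier G = carrier K"
    and odd: "\<And>y. y \<in> carrier K \<Longrightarrow> odd (card {x \<in> carrier G. f x = y})"
    using assms(1) unfolding odd_generation_cover_def by auto
  have finL: "finite L" using fin surj assms(2) by (metis finite_imageI finite_subset)
  have "{x \<in> carrier G. f x \<in> L} = (\<Union>y \<in> L. {x \<in> carrier G. f x = y})" by auto
  then have "card {x \<in> carrier G. f x \<in> L} = (\<Sum>y \<in> L. card {x \<in> carrier G. f x = y})"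
    using fin finL by (simp add: card_UN_disjoint disjoint_iff)
  moreover have "{y \<in> L. odd (card {x \<in> carrier G. f x = y})} = L"
    using odd assms(2) by auto
  ultimately show ?thesis using finL by (simp add: even_sum_iff)
qed

lemma odd_generation_cover_moves_iff:
  assumes "odd_generation_cover G K f" and "P \<subseteq> carrier G"
  shows "P' \<in> DNG_moves G P \<longleftrightarrow>
    (\<exists>g \<in> carrier G - P. P' = insert g P \<and> generate K (insert (f g) (f ` P)) \<noteq> carrier K)"
proof -
  have "insert g P \<in> DNG_positions G \<longleftrightarrow> generate K (insert (f g) (f ` P)) \<noteq> carrier K"
    if "g \<in> carrier G" for g
    using assms that unfolding odd_generation_cover_def DNG_positions_def
    by (metis (mono_tags, lifting) image_insert insert_subset mem_Collect_eq)
  then show ?thesis unfolding DNG_moves_def by auto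
qed

definition same_span_and_parity ::
    "('e, 'f) monoid_scheme \<Rightarrow> ('a, 'b) monoid_scheme \<Rightarrow> ('a \<Rightarrow> 'e) \<Rightarrow>
     ('c, 'd) monoid_scheme \<Rightarrow> ('c \<Rightarrow> 'e) \<Rightarrow> 'a set \<Rightarrow> 'c set \<Rightarrow> bool" where
  "same_span_and_parity K G f H h P Q \<longleftrightarrow>
     P \<subseteq> carrier G \<and> Q \<subseteq> carrier H \<and> generate K (f ` P) = generate K (h ` Q) \<and>
     (even (card P) \<longleftrightarrow> even (card Q))"

lemma same_span_and_parity_sym:
  "same_span_and_parity K G f H h P Q \<longleftrightarrow> same_span_and_parity K H h G f Q P"
  unfolding same_span_and_parity_def by auto

text \<open>A new span is reached in the other game by adding any element of the fibre of \<open>f g\<close>, where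
  \<open>g\<close> is the element just added. If the span is unchanged, any unused element of the preimage of
  the span serves as a reply. Parity decides the remaining case, in which \<open>Q\<close> fills that preimage:
  then \<open>P'\<close> has the wrong parity to fill its own, and adding one more element of it restores
  the relation to \<open>Q\<close>.\<close>

lemma same_span_and_parity_match_or_reverse:
  assumes "group K"
    and G: "odd_generation_cover G K f" and H: "odd_generation_cover H K h"
    and rel: "same_span_and_parity K G f H h P Q" and move: "P' \<in> DNG_moves G P"
  shows "(\<exists>Q' \<in> DNG_moves H Q. same_span_and_parity K G f H h P' Q') \<or>
    (\<exists>P'' \<in> DNG_moves G P'. same_span_and_parity K G f H h P'' Q)"
proof -
  interpret K: group K by fact
  have sub: "P \<subseteq> carrier G" "Q \<subseteq> carrier H"
    and span: "generate K (f ` P) = generate K (h ` Q)"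
    and parity: "even (card P) \<longleftrightarrow> even (card Q)"
    using rel unfolding same_span_and_parity_def by auto
  have finG: "finite (carrier G)" and finH: "finite (carrier H)"
    and imG: "f ` carrier G = carrier K" and imH: "h ` carrier H = carrier K"
    using G H unfolding odd_generation_cover_def by auto
  have fin: "finite P" "finite Q" using sub finG finH finite_subset by auto
  have fP: "f ` P \<subseteq> carrier K" and hQ: "h ` Q \<subseteq> carrier K"
    using image_mono[OF sub(1), of f] image_mono[OF sub(2), of h] imG imH by simp_all
  obtain g where g: "g \<in> carrier G" "g \<notin> P" and P': "P' = insert g P"
    and proper: "generate K (insert (f g) (f ` P)) \<noteq> carrier K"
    using move odd_generation_cover_moves_iff[OF G sub(1)] by auto
  have fg: "f g \<in> carrier K" using g imG by auto
  have P'_sub: "P' \<subseteq> carrier G" using P' g sub by simp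
  have answer: "\<exists>Q' \<in> DNG_moves H Q. same_span_and_parity K G f H h P' Q'"
    if "x \<in> carrier H" "x \<notin> Q"
      and eq: "generate K (insert (f g) (f ` P)) = generate K (insert (h x) (h ` Q))" for x
  proof
    show "insert x Q \<in> DNG_moves H Q"
      using that proper odd_generation_cover_moves_iff[OF H sub(2)] by auto
    show "same_span_and_parity K G f H h P' (insert x Q)"
      using that P' P'_sub sub parity g fin unfolding same_span_and_parity_def by simp
  qed
  let ?L = "generate K (f ` P)"
  have L: "?L \<subseteq> carrier K" using fP by (rule K.generate_incl)
  have P_in: "f ` P \<subseteq> ?L" and Q_in: "h ` Q \<subseteq> ?L"
    using generate.incl[of _ "f ` P" K] generate.incl[of _ "h ` Q" K] span by auto
  show ?thesis
  proof (cases "f g \<in> ?L")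
    case False
    obtain x where x: "x \<in> carrier H" "h x = f g" using fg imH by (metis imageE)
    then have "x \<notin> Q" using False Q_in by auto
    then show ?thesis
      using answer[of x] x K.generate_insert_cong[OF fP hQ fg span] by auto
  next
    case inner: True
    have span_P': "generate K (insert (f g) (f ` P)) = ?L"
      using K.generate_insert_absorb[OF fP inner] .
    show ?thesis
    proof (cases "{x \<in> carrier H. h x \<in> ?L} \<subseteq> Q")
      case False
      then obtain x where x: "x \<in> carrier H" "h x \<in> ?L" "x \<notin> Q" by auto
      then have "generate K (insert (h x) (h ` Q)) = ?L"
        using K.generate_insert_absorb[OF hQ, of "h x"] span by simp
      then show ?thesis using answer[of x] x span_P' by auto
    next
      case True
      then have "Q = {x \<in> carrier H. h x \<in> ?L}" using sub Q_in by auto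
      then have "even (card Q) \<longleftrightarrow> even (card {x \<in> carrier G. f x \<in> ?L})"
        using odd_generation_cover_even_card_vimage[OF G L]
          odd_generation_cover_even_card_vimage[OF H L] by simp
      moreover have "even (card P') \<longleftrightarrow> odd (card P)" using P' g fin by simp
      ultimately have "P' \<noteq> {x \<in> carrier G. f x \<in> ?L}" using parity by auto
      moreover have "P' \<subseteq> {x \<in> carrier G. f x \<in> ?L}"
        using P' P'_sub P_in inner by auto
      ultimately obtain y where y: "y \<in> carrier G" "f y \<in> ?L" "y \<notin> P'" by auto
      have "f ` P' \<subseteq> carrier K" and fP': "generate K (f ` P') = ?L"
        using P' fP fg span_P' by auto
      then have span_P'': "generate K (insert (f y) (f ` P')) = ?L"
        using K.generate_insert_absorb[of "f ` P'" "f y"] y by simp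
      have "insert y P' \<in> DNG_moves G P'"
        using odd_generation_cover_moves_iff[OF G P'_sub] y span_P'' span_P' proper by auto
      moreover have "same_span_and_parity K G f H h (insert y P') Q"
        using y P' P'_sub sub span span_P'' parity g fin
        unfolding same_span_and_parity_def by simp
      ultimately show ?thesis by blast
    qed
  qed
qed

lemma DNG_nim_eq_if_odd_generation_covers:
  assumes "group K" and G: "odd_generation_cover G K f" and H: "odd_generation_cover H K h"
  shows "DNG_nim G = DNG_nim H"
  unfolding DNG_nim_def
proof (rule DNG_nim_pos_eq_if_matched_or_reversed[where R = "same_span_and_parity K G f H h"])
  show "finite (carrier G)" "finite (carrier H)"
    using G H unfolding odd_generation_cover_def by auto
  show "same_span_and_parity K G f H h {} {}"
    unfolding same_span_and_parity_def by simp
next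
  fix P Q P'
  assume "same_span_and_parity K G f H h P Q" and "P' \<in> DNG_moves G P"
  then show "(\<exists>Q' \<in> DNG_moves H Q. same_span_and_parity K G f H h P' Q') \<or>
    (\<exists>P'' \<in> DNG_moves G P'. same_span_and_parity K G f H h P'' Q)"
    by (rule same_span_and_parity_match_or_reverse[OF assms])
next
  fix P Q Q'
  assume "same_span_and_parity K G f H h P Q" and "Q' \<in> DNG_moves H Q"
  then show "(\<exists>P' \<in> DNG_moves G P. same_span_and_parity K G f H h P' Q') \<or>
    (\<exists>Q'' \<in> DNG_moves H Q'. same_span_and_parity K G f H h P Q'')"
    using same_span_and_parity_match_or_reverse[OF assms(1) H G, of Q P Q']
    by (simp add: same_span_and_parity_sym[of K H h])
qed

section \<open>The projection modulo a subgroup of the Frattini subgroup\<close>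

lemma (in group) ex_maximal_subgroup:
  assumes "finite (carrier G)" and "subgroup H G" and "H \<noteq> carrier G"
  shows "\<exists>M. maximal_subgroup M G \<and> H \<subseteq> M"
proof -
  let ?A = "{L. subgroup L G \<and> L \<noteq> carrier G}"
  have "?A \<subseteq> Pow (carrier G)" using subgroup.subset by blast
  then have "finite ?A" using assms(1) by (meson finite_Pow_iff finite_subset)
  from finite_has_maximal2[OF this, of H] assms(2,3)
  obtain M where M: "M \<in> ?A" "H \<subseteq> M" "\<And>L. L \<in> ?A \<Longrightarrow> M \<subseteq> L \<Longrightarrow> M = L" by auto
  then show ?thesis unfolding maximal_subgroup_def by (intro exI[of _ M]) auto
qed

text \<open>The Frattini subgroup consists of non-generators: if \<open>P\<close> does not generate \<open>G\<close>, it lies in a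
  maximal subgroup \<open>M\<close>. As \<open>M\<close> contains \<open>N\<close>, it is a union of cosets of \<open>N\<close>, hence its image is
  still proper and contains the image of \<open>P\<close>.\<close>

lemma (in normal) generate_FactGroup_eq_carrier_iff:
  assumes fin: "finite (carrier G)" and fr: "H \<subseteq> frattini G" and P: "P \<subseteq> carrier G"
  shows "generate (G Mod H) ((\<lambda>a. H #> a) ` P) = carrier (G Mod H) \<longleftrightarrow>
    generate G P = carrier G"
proof -
  interpret Q: group "G Mod H" by (rule factorgroup_is_group)
  interpret pr: group_hom G "G Mod H" "\<lambda>a. H #> a"
    by unfold_locales (rule r_coset_hom_Mod)
  have surj: "(\<lambda>a. H #> a) ` carrier G = carrier (G Mod H)"
    by (auto simp: FactGroup_def RCOSETS_def)
  have img: "generate (G Mod H) ((\<lambda>a. H #> a) ` P) = (\<lambda>a. H #> a) ` generate G P"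
    using pr.generate_img[OF P] by simp
  show ?thesis
  proof
    assume "generate G P = carrier G"
    then show "generate (G Mod H) ((\<lambda>a. H #> a) ` P) = carrier (G Mod H)"
      using img surj by simp
  next
    assume gen: "generate (G Mod H) ((\<lambda>a. H #> a) ` P) = carrier (G Mod H)"
    show "generate G P = carrier G"
    proof (rule ccontr)
      assume "generate G P \<noteq> carrier G"
      then obtain M where M: "maximal_subgroup M G" "generate G P \<subseteq> M"
        using ex_maximal_subgroup[OF fin generate_is_subgroup[OF P]] by auto
      have sM: "subgroup M G" and proper: "M \<noteq> carrier G"
        using M unfolding maximal_subgroup_def by auto
      have HM: "H \<subseteq> M" using fr M unfolding frattini_def by auto
      have "carrier G \<subseteq> M"
      proof
        fix x assume x: "x \<in> carrier G"
        then have "H #> x \<in> (\<lambda>a. H #> a) ` generate G P" using surj gen img by auto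
        then obtain m where m: "m \<in> M" "H #> x = H #> m" using M(2) by auto
        have "x \<in> H #> m" using m(2) rcos_self[OF x] subgroup_axioms by auto
        then show "x \<in> M"
          using m(1) HM subgroup.m_closed[OF sM] unfolding r_coset_def by auto
      qed
      then show False using proper subgroup.subset[OF sM] by auto
    qed
  qed
qed

lemma (in normal) odd_generation_cover_FactGroup:
  assumes fin: "finite (carrier G)" and "odd (card H)" and "H \<subseteq> frattini G"
  shows "odd_generation_cover G (G Mod H) (\<lambda>a. H #> a)"
proof -
  have "odd (card {x \<in> carrier G. H #> x = C})" if "C \<in> carrier (G Mod H)" for C
  proof -
    have C: "C \<in> rcosets H" using that by (simp add: FactGroup_def)
    then obtain a where a: "a \<in> carrier G" "C = H #> a" by (auto simp: RCOSETS_def)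
    have "{x \<in> carrier G. H #> x = C} = C"
    proof
      show "{x \<in> carrier G. H #> x = C} \<subseteq> C" using rcos_self subgroup_axioms by auto
      show "C \<subseteq> {x \<in> carrier G. H #> x = C}"
        using a repr_independence subgroup_axioms r_coset_subset_G subset by blast
    qed
    moreover have "card C = card H" using card_rcosets_equal[OF C subset] by simp
    ultimately show ?thesis using assms(2) by simp
  qed
  moreover have "(\<lambda>a. H #> a) ` carrier G = carrier (G Mod H)"
    by (auto simp: FactGroup_def RCOSETS_def)
  ultimately show ?thesis
    using fin generate_FactGroup_eq_carrier_iff[OF fin assms(3)]
    unfolding odd_generation_cover_def by auto
qed

lemma odd_generation_cover_id:
  assumes "finite (carrier G)"
  shows "odd_generation_cover G G (\<lambda>x. x)"
proof -
  have "{x \<in> carrier G. x = y} = {y}" if "y \<in> carrier G" for y using that by auto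
  then show ?thesis using assms unfolding odd_generation_cover_def by simp
qed

theorem proposition8p1:
  fixes G :: "('a, 'b) monoid_scheme" and N :: "'a set"
  assumes "group G" and "finite (carrier G)" and "carrier G \<noteq> {\<one>\<^bsub>G\<^esub>}"
    and "N \<lhd> G" and "odd (card N)" and "N \<subseteq> frattini G"
  shows "DNG_nim G = DNG_nim (G Mod N)"
proof (rule DNG_nim_eq_if_odd_generation_covers)
  interpret N: normal N G by fact
  show "group (G Mod N)" by (rule N.factorgroup_is_group)
  show cover: "odd_generation_cover G (G Mod N) (\<lambda>a. N #>\<^bsub>G\<^esub> a)"
    using N.odd_generation_cover_FactGroup assms by simp
  have "finite (carrier (G Mod N))"
    using cover unfolding odd_generation_cover_def by (metis finite_imageI)
  then show "odd_generation_cover (G Mod N) (G Mod N) (\<lambda>x. x)"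
    by (rule odd_generation_cover_id)
qed

end
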